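(* Let $\{g_n\}_{n=0}^\infty$ be a log-convex sequence independent of $\mu$, and let $$g(\mu;x)=\sum_{n=0}^\infty g_n\frac{(\mu)_{2n}}{(2n)!}x^n=\sum_{n=0}^\infty g_n\frac{(\mu/2)_n((\mu+1)/2)_n}{(1/2)_n\,n!}x^n .$$ Then the formal power series $g(\mu;x)$ is coefficient-wise log-convex for $\mu>0$.
   Context: $(\mu)_n$ is the rising factorial: $(\mu)_0=1$, $(\mu)_n=\mu(\mu+1)\cdots(\mu+n-1)$. A non-negative, not identically zero real sequence $\{g_k\}_{k\ge0}$ is called log-convex if $g_k^2\le g_{k-1}g_{k+1}$ for all $k\ge1$. For a formal power series $f(\mu;x)$ in $x$ whose coefficients are non-negative functions of a real parameter $\mu$, and for $\alpha,\beta\ge0$, the generalized Turánian is the formal power series $$\Delta_f(\alpha,\beta;x)=f(\mu+\alpha;x)f(\mu+\beta;x)-f(\mu;x)f(\mu+\alpha+\beta;x)=\sum_{k\ge0}\delta_kx^k .$$ "$f$ is coefficient-wise log-convex for $\mu>0$" means $\delta_k\le0$ for all $k\ge0$, all $\mu>0$ and all $\alpha,\beta\ge0$. *)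

theory Defs
  imports Complex_Main "HOL-Computational_Algebra.Formal_Power_Series"
begin

definition log_convex_seq :: "(nat \<Rightarrow> real) \<Rightarrow> bool" where
  "log_convex_seq g \<longleftrightarrow>
     (\<forall>k. 0 \<le> g k) \<and> (\<exists>k. g k \<noteq> 0) \<and>
     (\<forall>k\<ge>1. (g k)\<^sup>2 \<le> g (k - 1) * g (k + 1))"

text \<open>A formal power series depending on a real parameter is a function from the reals to
  \<^typ>\<open>real fps\<close>.\<close>

definition turanian :: "(real \<Rightarrow> real fps) \<Rightarrow> real \<Rightarrow> real \<Rightarrow> real \<Rightarrow> real fps" where
  "turanian f \<mu> \<alpha> \<beta> = f (\<mu> + \<alpha>) * f (\<mu> + \<beta>) - f \<mu> * f (\<mu> + \<alpha> + \<beta>)"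

definition coeffwise_log_convex :: "(real \<Rightarrow> real fps) \<Rightarrow> bool" where
  "coeffwise_log_convex f \<longleftrightarrow>
     (\<forall>\<mu>>0. \<forall>\<alpha>\<ge>0. \<forall>\<beta>\<ge>0. \<forall>k. fps_nth (turanian f \<mu> \<alpha> \<beta>) k \<le> 0)"

definition g_series :: "(nat \<Rightarrow> real) \<Rightarrow> real \<Rightarrow> real fps" where
  "g_series g \<mu> = Abs_fps (\<lambda>n. g n * (pochhammer \<mu> (2 * n) / fact (2 * n)))"

end

theory Submission
  imports Defs
begin

text \<open>The \<open>k\<close>-th coefficient of the Turanian is a sum of \<open>g j * g (k - j)\<close> against weights that do
  not depend on \<open>g\<close>. After symmetrisation in \<open>j \<leftrightarrow> k - j\<close>, the factors \<open>g j * g (k - j)\<close> decrease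
  for \<open>j \<le> k / 2\<close> by log-convexity, while the weights change sign at most once there, from
  negative to nonnegative. Hence the sum is at most a nonnegative multiple of the sum of the weights,
  that is, of the same coefficient for \<open>g = 1\<close>. In that case, with \<open>x = y\<^sup>2\<close>, the
  series is the even part of \<open>(1 - y)\<^bsup>-\<mu>\<^esup>\<close> and the Turanian factors as
  \<open>-(1/4) (1 - y\<^sup>2)\<^bsup>-\<mu>\<^esup> ((1-y)\<^bsup>-\<alpha>\<^esup> - (1+y)\<^bsup>-\<alpha>\<^esup>) ((1-y)\<^bsup>-\<beta>\<^esup> - (1+y)\<^bsup>-\<beta>\<^esup>)\<close>.\<close>

section \<open>Log-convex sequences\<close>

lemma log_convex_seq_nonneg: "log_convex_seq g \<Longrightarrow> 0 \<le> g k"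
  by (simp add: log_convex_seq_def)

text \<open>Log-convexity means that ratios of consecutive terms increase; the cross-multiplied form
  tolerates zero terms. Induction on \<open>d\<close> chains the defining inequality at
  \<open>Suc (i + d)\<close>.\<close>

lemma log_convex_seq_step:
  assumes "log_convex_seq g"
  shows "g (Suc i) * g (i + d) \<le> g i * g (Suc (i + d))"
proof (induction d)
  case 0
  then show ?case by simp
next
  case (Suc d)
  let ?a = "g (i + d)" and ?b = "g (Suc (i + d))" and ?c = "g (Suc (Suc (i + d)))"
  have nn: "0 \<le> g k" for k
    using assms by (rule log_convex_seq_nonneg)
  have sq: "?b\<^sup>2 \<le> ?a * ?c"
    using assms[unfolded log_convex_seq_def] by (auto dest!: spec[of _ "Suc (i + d)"])
  show ?case
  proof (cases "?b = 0")
    case True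
    then show ?thesis using nn by simp
  next
    case False
    then have "0 < ?b\<^sup>2" by simp
    with sq have "0 < ?a * ?c" by linarith
    with nn have a: "0 < ?a" by (metis less_eq_real_def mult_zero_left order_less_irrefl)
    have "?a * (g (Suc i) * ?b) = (g (Suc i) * ?a) * ?b" by simp
    also have "\<dots> \<le> (g i * ?b) * ?b" using Suc nn by (intro mult_right_mono) auto
    also have "\<dots> = g i * ?b\<^sup>2" by (simp add: power2_eq_square)
    also have "\<dots> \<le> g i * (?a * ?c)" using sq nn by (intro mult_left_mono) auto
    also have "\<dots> = ?a * (g i * ?c)" by simp
    finally show ?thesis using a by simp
  qed
qed

lemma log_convex_seq_prod_antimono:
  assumes "log_convex_seq g" "j \<le> i" "2 * i \<le> k"
  shows "g i * g (k - i) \<le> g j * g (k - j)"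
  using assms(2,3)
proof (induction i rule: dec_induct)
  case base
  then show ?case by simp
next
  case (step i)
  have "g (Suc i) * g (k - Suc i) \<le> g i * g (k - i)"
    using log_convex_seq_step[OF assms(1), of i "k - Suc i - i"] step.prems
    by (simp add: Suc_diff_Suc)
  also have "\<dots> \<le> g j * g (k - j)" using step by simp
  finally show ?case .
qed

section \<open>Sign changes of symmetrised products of Pochhammer symbols\<close>

text \<open>At equal lengths, the paired factors with the same index differ by
  \<open>\<alpha> * \<beta>\<close>; each further factor up to \<open>b\<close> is larger by \<beta>
  on the right.\<close>

lemma pochhammer_cross_mono:
  fixes \<mu> \<alpha> \<beta> :: real
  assumes "0 < \<mu>" "0 \<le> \<alpha>" "0 \<le> \<beta>" "a \<le> b"
  shows "pochhammer \<mu> b * pochhammer (\<mu> + \<alpha> + \<beta>) a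
       \<le> pochhammer (\<mu> + \<alpha>) a * pochhammer (\<mu> + \<beta>) b"
  using assms(4)
proof (induction b rule: dec_induct)
  case base
  show ?case
  proof (induction a)
    case 0
    then show ?case by simp
  next
    case (Suc a)
    have "(\<mu> + a) * (\<mu> + \<alpha> + \<beta> + a) \<le> (\<mu> + \<alpha> + a) * (\<mu> + \<beta> + a)"
      using assms by (simp add: algebra_simps)
    then have "(pochhammer \<mu> a * pochhammer (\<mu> + \<alpha> + \<beta>) a) * ((\<mu> + a) * (\<mu> + \<alpha> + \<beta> + a))
       \<le> (pochhammer (\<mu> + \<alpha>) a * pochhammer (\<mu> + \<beta>) a) * ((\<mu> + \<alpha> + a) * (\<mu> + \<beta> + a))"
      using assms by (intro mult_mono[OF Suc.IH]) (auto intro!: mult_nonneg_nonneg pochhammer_nonneg)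
    then show ?case by (simp add: pochhammer_rec' mult_ac)
  qed
next
  case (step b)
  have "(pochhammer \<mu> b * pochhammer (\<mu> + \<alpha> + \<beta>) a) * (\<mu> + b)
     \<le> (pochhammer (\<mu> + \<alpha>) a * pochhammer (\<mu> + \<beta>) b) * (\<mu> + \<beta> + b)"
    using assms by (intro mult_mono[OF step.IH]) (auto intro!: mult_nonneg_nonneg pochhammer_nonneg)
  then show ?case by (simp add: pochhammer_rec' mult_ac)
qed

text \<open>The symmetrised weight with its factorials cleared. Odd \<open>a\<close> and
  \<open>b\<close> are allowed so that the sign can be followed one unit at a time.\<close>

definition poch_turan :: "real \<Rightarrow> real \<Rightarrow> real \<Rightarrow> nat \<Rightarrow> nat \<Rightarrow> real" where
  "poch_turan \<mu> \<alpha> \<beta> a b =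
     pochhammer (\<mu> + \<alpha>) a * pochhammer (\<mu> + \<beta>) b + pochhammer (\<mu> + \<alpha>) b * pochhammer (\<mu> + \<beta>) a
   - pochhammer \<mu> a * pochhammer (\<mu> + \<alpha> + \<beta>) b - pochhammer \<mu> b * pochhammer (\<mu> + \<alpha> + \<beta>) a"

lemma poch_turan_commute: "poch_turan \<mu> \<alpha> \<beta> a b = poch_turan \<mu> \<beta> \<alpha> a b"
  by (simp add: poch_turan_def algebra_simps)

text \<open>Multiplied by \<open>y + \<alpha>\<close>, the new value is \<open>x + \<beta>\<close>
  times the old one plus a remainder, which is nonnegative thanks to
  \<open>\<beta> \<le> \<alpha>\<close>.\<close>

lemma poch_turan_step_aux:
  fixes \<mu> \<alpha> \<beta> :: real
  assumes "0 < \<mu>" "0 \<le> \<beta>" "\<beta> \<le> \<alpha>" "a \<le> b" "0 \<le> poch_turan \<mu> \<alpha> \<beta> a (Suc b)"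
  shows "0 \<le> poch_turan \<mu> \<alpha> \<beta> (Suc a) b"
proof -
  define x y where "x = \<mu> + a" and "y = \<mu> + b"
  define u v r s where
    "u = pochhammer (\<mu> + \<alpha>) a * pochhammer (\<mu> + \<beta>) b" and
    "v = pochhammer (\<mu> + \<alpha>) b * pochhammer (\<mu> + \<beta>) a" and
    "r = pochhammer \<mu> a * pochhammer (\<mu> + \<alpha> + \<beta>) b" and
    "s = pochhammer \<mu> b * pochhammer (\<mu> + \<alpha> + \<beta>) a"
  have old: "poch_turan \<mu> \<alpha> \<beta> a (Suc b)
      = u * (y + \<beta>) + v * (y + \<alpha>) - r * (y + \<alpha> + \<beta>) - s * y"
    by (simp add: poch_turan_def u_def v_def r_def s_def y_def pochhammer_rec' algebra_simps)
  have new: "poch_turan \<mu> \<alpha> \<beta> (Suc a) b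
      = u * (x + \<alpha>) + v * (x + \<beta>) - r * x - s * (x + \<alpha> + \<beta>)"
    by (simp add: poch_turan_def u_def v_def r_def s_def x_def pochhammer_rec' algebra_simps)
  have su: "s \<le> u"
    unfolding s_def u_def using assms by (intro pochhammer_cross_mono) auto
  have sr: "s \<le> r"
    using pochhammer_cross_mono[of \<mu> 0 "\<alpha> + \<beta>" a b] assms
    by (simp add: s_def r_def add.assoc)
  \<comment> \<open>Passing from \<open>(a, Suc b)\<close> to \<open>(Suc a, b)\<close> multiplies each of the four terms by a ratio \<open>S / d - 1\<close>
    with the same \<open>S = x + y + \<alpha> + \<beta>\<close>; we compare all ratios with that of the second term, whose \<open>d\<close>
    is \<open>y + \<alpha>\<close>.\<close>
  have bracket: "0 \<le> (\<alpha> - \<beta>) * (u - s) + \<beta> * (r - s)"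
    using su sr assms by (intro add_nonneg_nonneg mult_nonneg_nonneg) auto
  have "0 \<le> (x + \<beta>) * poch_turan \<mu> \<alpha> \<beta> a (Suc b)
      + (x + y + \<alpha> + \<beta>) * ((\<alpha> - \<beta>) * (u - s) + \<beta> * (r - s))"
    using assms by (intro add_nonneg_nonneg[OF mult_nonneg_nonneg mult_nonneg_nonneg[OF _ bracket]])
      (auto simp: x_def y_def)
  also have "\<dots> = (y + \<alpha>) * poch_turan \<mu> \<alpha> \<beta> (Suc a) b"
    unfolding old new by (simp add: algebra_simps)
  finally show ?thesis
    using assms by (simp add: zero_le_mult_iff y_def)
qed

lemma poch_turan_step:
  fixes \<mu> \<alpha> \<beta> :: real
  assumes "0 < \<mu>" "0 \<le> \<alpha>" "0 \<le> \<beta>" "a \<le> b" "0 \<le> poch_turan \<mu> \<alpha> \<beta> a (Suc b)"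
  shows "0 \<le> poch_turan \<mu> \<alpha> \<beta> (Suc a) b"
  using poch_turan_step_aux[of \<mu> \<beta> \<alpha> a b] poch_turan_step_aux[of \<mu> \<alpha> \<beta> a b] assms
  by (cases "\<beta> \<le> \<alpha>") (auto simp: poch_turan_commute[of \<mu> \<beta> \<alpha>])

text \<open>Each increment of \<open>i\<close> consists of two unit shifts, passing through a pair
  of odd lengths.\<close>

lemma poch_turan_mono_sign:
  fixes \<mu> \<alpha> \<beta> :: real
  assumes "0 < \<mu>" "0 \<le> \<alpha>" "0 \<le> \<beta>" "j \<le> i" "2 * i \<le> k"
    and "0 \<le> poch_turan \<mu> \<alpha> \<beta> (2 * j) (2 * (k - j))"
  shows "0 \<le> poch_turan \<mu> \<alpha> \<beta> (2 * i) (2 * (k - i))"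
  using assms(4,5)
proof (induction i rule: dec_induct)
  case base
  then show ?case using assms by simp
next
  case (step i)
  define m where "m = k - Suc i"
  have m: "k - i = Suc m" "Suc i \<le> m" using step.prems by (auto simp: m_def)
  have "0 \<le> poch_turan \<mu> \<alpha> \<beta> (2 * i) (Suc (Suc (2 * m)))"
    using step m by simp
  then have "0 \<le> poch_turan \<mu> \<alpha> \<beta> (Suc (2 * i)) (Suc (2 * m))"
    using assms m by (intro poch_turan_step[of _ _ _ _ "Suc (2 * m)"]) auto
  then have "0 \<le> poch_turan \<mu> \<alpha> \<beta> (Suc (Suc (2 * i))) (2 * m)"
    using assms m by (intro poch_turan_step[of _ _ _ _ "2 * m"]) auto
  then show ?case by (simp add: m_def)
qed

section \<open>The constant sequence\<close>

text \<open>The binomial series of \<open>(1 - c X)^(-a)\<close>.\<close>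

definition neg_binom :: "real \<Rightarrow> real \<Rightarrow> real fps" where
  "neg_binom c a = Abs_fps (\<lambda>n. c ^ n * pochhammer a n / fact n)"

text \<open>Coefficientwise this is the Chu-Vandermonde identity for rising factorials.\<close>

lemma neg_binom_add: "neg_binom c (a + b) = neg_binom c a * neg_binom c b"
proof (rule fps_ext)
  fix n
  have "fps_nth (neg_binom c (a + b)) n
      = (\<Sum>k\<le>n. c ^ n * (real (n choose k) * pochhammer a k * pochhammer b (n - k)) / fact n)"
    by (simp add: neg_binom_def pochhammer_binomial_sum sum_distrib_left sum_divide_distrib)
  also have "\<dots> = (\<Sum>k\<le>n. (c ^ k * pochhammer a k / fact k)
      * (c ^ (n - k) * pochhammer b (n - k) / fact (n - k)))"
    by (intro sum.cong refl) (simp add: binomial_fact flip: power_add)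
  also have "\<dots> = fps_nth (neg_binom c a * neg_binom c b) n"
    by (simp add: neg_binom_def fps_mult_nth atMost_atLeast0)
  finally show "fps_nth (neg_binom c (a + b)) n = fps_nth (neg_binom c a * neg_binom c b) n" .
qed

lemma neg_binom_deriv:
  "fps_deriv (neg_binom c a) * (1 - fps_const c * fps_X) = fps_const (c * a) * neg_binom c a"
proof (rule fps_ext)
  fix n
  have D: "fps_nth (fps_deriv (neg_binom c a)) n = c ^ Suc n * pochhammer a (Suc n) / fact n" for n
    by (simp add: neg_binom_def del: of_nat_Suc)
  show "fps_nth (fps_deriv (neg_binom c a) * (1 - fps_const c * fps_X)) n
      = fps_nth (fps_const (c * a) * neg_binom c a) n"
  proof (cases n)
    case 0
    then show ?thesis
      by (simp add: D algebra_simps del: fps_deriv_nth) (simp add: neg_binom_def)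
  next
    case (Suc m)
    have "fps_deriv (neg_binom c a) * (1 - fps_const c * fps_X)
        = fps_deriv (neg_binom c a) - fps_const c * (fps_deriv (neg_binom c a) * fps_X)"
      by (simp add: algebra_simps)
    moreover define q :: real where "q = fact (Suc m)"
    moreover have "x / fact m = x * real (Suc m) / q" for x :: real
      by (simp add: q_def del: of_nat_Suc)
    ultimately show ?thesis
      by (simp add: Suc D del: fps_deriv_nth of_nat_Suc fact_Suc)
        (simp add: neg_binom_def pochhammer_rec'[of a "Suc m"] algebra_simps add_divide_distrib
          del: of_nat_Suc fact_Suc)
  qed
qed

text \<open>The product below is \<open>(1 - X\<^sup>2)\<^bsup>-\<mu>\<^esup>\<close>; its differential equation gives a two-term
  recurrence with nonnegative factors.\<close>

lemma neg_binom_mult_nonneg: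
  assumes "0 < \<mu>"
  shows "0 \<le> fps_nth (neg_binom 1 \<mu> * neg_binom (-1) \<mu>) n"
proof -
  define F G where "F = neg_binom 1 \<mu>" and "G = neg_binom (-1) \<mu>"
  define H where "H = F * G"
  have F: "fps_deriv F * (1 - fps_X) = fps_const \<mu> * F"
    using neg_binom_deriv[of 1 \<mu>] by (simp add: F_def)
  have G: "fps_deriv G * (1 + fps_X) = - (fps_const \<mu> * G)"
    using neg_binom_deriv[of "-1" \<mu>] by (simp add: G_def fps_const_neg[symmetric] del: fps_const_neg)
  \<comment> \<open>The left side is \<open>(1 - X^2) H'\<close>; splitting \<open>1 - X^2\<close>
    as \<open>(1 - X) (1 + X)\<close> lets the equations \<open>F\<close> and \<open>G\<close> apply
    to the two terms of the product rule.\<close>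
  have "fps_deriv H - fps_X * (fps_X * fps_deriv H)
      = (fps_deriv F * (1 - fps_X)) * G * (1 + fps_X) + F * (fps_deriv G * (1 + fps_X)) * (1 - fps_X)"
    by (simp add: H_def algebra_simps)
  also have "\<dots> = fps_X * (fps_const (2 * \<mu>) * H)"
    unfolding F G H_def by (simp add: algebra_simps flip: fps_const_mult) (simp add: fps_numeral_fps_const)
  finally have eq: "fps_deriv H
      = fps_X * (fps_X * fps_deriv H) + fps_X * (fps_const (2 * \<mu>) * H)"
    by (simp only: diff_eq_eq add.commute)
  have rec1: "fps_nth H (Suc 0) = 0"
    using arg_cong[OF eq, of "\<lambda>f. fps_nth f 0"] by simp
  have rec2: "fps_nth H (Suc (Suc n)) * (real n + 2)
      = fps_nth H n * (real n + 2 * \<mu>)" for n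
    using arg_cong[OF eq, of "\<lambda>f. fps_nth f (Suc n)"]
    by (cases n) (simp_all add: algebra_simps)
  have "0 \<le> fps_nth H n"
  proof (induction n rule: induct_nat_012)
    case 0
    then show ?case by (simp add: H_def F_def G_def neg_binom_def)
  next
    case 1
    then show ?case using rec1 by simp
  next
    case (ge2 n)
    then have "0 \<le> fps_nth H (Suc (Suc n)) * (real n + 2)"
      using assms by (simp add: rec2 del: of_nat_Suc)
    then show ?case by (simp add: zero_le_mult_iff)
  qed
  then show ?thesis by (simp add: H_def F_def G_def)
qed

text \<open>Twice the even part of \<open>(1 - X)^(-a)\<close>, hence the factor 4 in
  \<open>cosh_binom_mult_nth\<close>; \<open>sinh_binom\<close> is twice the odd part.\<close>

definition cosh_binom :: "real \<Rightarrow> real fps" where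
  "cosh_binom a = neg_binom 1 a + neg_binom (-1) a"

definition sinh_binom :: "real \<Rightarrow> real fps" where
  "sinh_binom a = neg_binom 1 a - neg_binom (-1) a"

text \<open>After \<open>neg_binom_add\<close>, the terms with equal signs of \<open>c\<close>
  cancel and the mixed ones factor.\<close>

lemma cosh_binom_turan:
  "cosh_binom (\<mu> + \<alpha>) * cosh_binom (\<mu> + \<beta>) - cosh_binom \<mu> * cosh_binom (\<mu> + \<alpha> + \<beta>)
   = - ((neg_binom 1 \<mu> * neg_binom (-1) \<mu>) * (sinh_binom \<alpha> * sinh_binom \<beta>))"
  by (simp add: cosh_binom_def sinh_binom_def neg_binom_add algebra_simps)

lemma fps_mult_nth_nonneg:
  fixes f g :: "'a :: linordered_semidom fps"
  assumes "\<And>n. 0 \<le> fps_nth f n" "\<And>n. 0 \<le> fps_nth g n"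
  shows "0 \<le> fps_nth (f * g) n"
  using assms by (auto simp: fps_mult_nth intro!: sum_nonneg mult_nonneg_nonneg)

lemma sinh_binom_nonneg: "0 \<le> a \<Longrightarrow> 0 \<le> fps_nth (sinh_binom a) n"
  by (cases "a = 0"; cases "even n")
    (auto simp: sinh_binom_def neg_binom_def pochhammer_0_left
      intro!: divide_nonneg_nonneg pochhammer_nonneg)

lemma cosh_binom_turan_nonpos:
  assumes "0 < \<mu>" "0 \<le> \<alpha>" "0 \<le> \<beta>"
  shows "fps_nth (cosh_binom (\<mu> + \<alpha>) * cosh_binom (\<mu> + \<beta>)
           - cosh_binom \<mu> * cosh_binom (\<mu> + \<alpha> + \<beta>)) n \<le> 0"
proof -
  have "0 \<le> fps_nth ((neg_binom 1 \<mu> * neg_binom (-1) \<mu>) * (sinh_binom \<alpha> * sinh_binom \<beta>)) n"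
    using assms by (intro fps_mult_nth_nonneg neg_binom_mult_nonneg sinh_binom_nonneg) auto
  then show ?thesis unfolding cosh_binom_turan by simp
qed

definition even_poch :: "real \<Rightarrow> nat \<Rightarrow> real" where
  "even_poch a n = pochhammer a (2 * n) / fact (2 * n)"

lemma sum_atMost_double_even:
  fixes f :: "nat \<Rightarrow> 'a :: comm_monoid_add"
  assumes "\<And>i. odd i \<Longrightarrow> f i = 0"
  shows "(\<Sum>i\<le>2 * k. f i) = (\<Sum>j\<le>k. f (2 * j))"
  by (induction k) (simp_all add: assms)

lemma cosh_binom_mult_nth:
  "fps_nth (cosh_binom a * cosh_binom b) (2 * k) = 4 * (\<Sum>j\<le>k. even_poch a j * even_poch b (k - j))"
proof -
  have "fps_nth (cosh_binom a * cosh_binom b) (2 * k)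
      = (\<Sum>i\<le>2 * k. fps_nth (cosh_binom a) i * fps_nth (cosh_binom b) (2 * k - i))"
    by (simp add: fps_mult_nth atMost_atLeast0)
  also have "\<dots> = (\<Sum>j\<le>k. fps_nth (cosh_binom a) (2 * j) * fps_nth (cosh_binom b) (2 * k - 2 * j))"
    by (intro sum_atMost_double_even) (simp add: cosh_binom_def neg_binom_def)
  also have "\<dots> = (\<Sum>j\<le>k. 4 * (even_poch a j * even_poch b (k - j)))"
    by (intro sum.cong refl)
      (simp add: cosh_binom_def neg_binom_def even_poch_def flip: diff_mult_distrib2)
  finally show ?thesis by (simp add: sum_distrib_left)
qed

section \<open>Summation\<close>

text \<open>Replacing \<open>h\<close> by its value \<open>t\<close> at the sign change of
  \<open>w\<close> only increases each term: before it \<open>w\<close> is negative and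
  \<open>h\<close> at least \<open>t\<close>, after it \<open>w\<close> is nonnegative and
  \<open>h\<close> at most \<open>t\<close>.\<close>

lemma sum_symmetric_sign_change_nonpos:
  fixes h w :: "nat \<Rightarrow> real"
  assumes h_nonneg: "\<And>j. 0 \<le> h j"
    and h_sym: "\<And>j. j \<le> k \<Longrightarrow> h (k - j) = h j"
    and h_anti: "\<And>i j. j \<le> i \<Longrightarrow> 2 * i \<le> k \<Longrightarrow> h i \<le> h j"
    and w_sym: "\<And>j. j \<le> k \<Longrightarrow> w (k - j) = w j"
    and w_sign: "\<And>i j. j \<le> i \<Longrightarrow> 2 * i \<le> k \<Longrightarrow> 0 \<le> w j \<Longrightarrow> 0 \<le> w i"
    and w_sum: "(\<Sum>j\<le>k. w j) \<le> 0"
  shows "(\<Sum>j\<le>k. h j * w j) \<le> 0"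
proof -
  have "\<exists>t\<ge>0. \<forall>j. 2 * j \<le> k \<longrightarrow> h j * w j \<le> t * w j"
  proof (cases "\<exists>j. 2 * j \<le> k \<and> 0 \<le> w j")
    \<comment> \<open>The weights are negative on the whole lower half, so \<open>t = 0\<close>
      serves.\<close>
    case False
    then have "h j * w j \<le> 0 * w j" if "2 * j \<le> k" for j
      using h_nonneg[of j] that by (intro mult_right_mono_neg) auto
    then show ?thesis by blast
  next
    case True
    define m where "m = (LEAST j. 2 * j \<le> k \<and> 0 \<le> w j)"
    have m: "2 * m \<le> k" "0 \<le> w m"
      using LeastI_ex[OF True] by (auto simp: m_def)
    have "h j * w j \<le> h m * w j" if j: "2 * j \<le> k" for j
    proof (cases "j < m")
      case True
      then have "w j < 0" using not_less_Least[of j] j by (force simp: m_def)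
      moreover have "h m \<le> h j" using True m h_anti by simp
      ultimately show ?thesis by (intro mult_right_mono_neg) auto
    next
      case False
      then have "0 \<le> w j" "h j \<le> h m" using w_sign[of m j] h_anti[of m j] j m by auto
      then show ?thesis by (intro mult_right_mono)
    qed
    then show ?thesis using h_nonneg by blast
  qed
  then obtain t where t: "0 \<le> t" and le: "\<And>j. 2 * j \<le> k \<Longrightarrow> h j * w j \<le> t * w j"
    by blast
  have "(\<Sum>j\<le>k. h j * w j) \<le> (\<Sum>j\<le>k. t * w j)"
  proof (rule sum_mono)
    \<comment> \<open>Indices above \<open>k / 2\<close> are reflected to the lower half.\<close>
    fix j assume "j \<in> {..k}"
    then show "h j * w j \<le> t * w j"
      using le[of j] le[of "k - j"] h_sym[of j] w_sym[of j] by (cases "2 * j \<le> k") auto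
  qed
  also have "\<dots> = t * (\<Sum>j\<le>k. w j)" by (simp add: sum_distrib_left)
  also have "\<dots> \<le> 0" using t w_sum by (simp add: mult_nonneg_nonpos)
  finally show ?thesis .
qed

lemma sum_atMost_symmetrise:
  fixes f :: "nat \<Rightarrow> 'a :: semiring_1"
  shows "(\<Sum>j\<le>k. f j + f (k - j)) = 2 * (\<Sum>j\<le>k. f j)"
proof -
  have "(\<Sum>j\<le>k. f (k - j)) = (\<Sum>j\<le>k. f j)"
    by (rule sum.reindex_bij_witness[of _ "\<lambda>j. k - j" "\<lambda>j. k - j"]) auto
  then show ?thesis by (simp add: sum.distrib mult_2)
qed

theorem theorem3p2:
  fixes g :: "nat \<Rightarrow> real"
  assumes "log_convex_seq g"
  shows "(\<forall>\<mu>. g_series g \<mu> =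
            Abs_fps (\<lambda>n. g n * (pochhammer (\<mu> / 2) n * pochhammer ((\<mu> + 1) / 2) n
                                / (pochhammer (1 / 2) n * fact n))))
         \<and> coeffwise_log_convex (g_series g)"
proof
  \<comment> \<open>Duplication formulas above and below the line; the powers of 2 cancel.\<close>
  have "pochhammer \<mu> (2 * n) / fact (2 * n)
      = pochhammer (\<mu> / 2) n * pochhammer ((\<mu> + 1) / 2) n / (pochhammer (1 / 2) n * fact n)"
    for \<mu> :: real and n
    using pochhammer_double[of "\<mu> / 2" n] fact_double[of n, where 'a = real]
    by (simp add: add_divide_distrib)
  then show "\<forall>\<mu>. g_series g \<mu> =
      Abs_fps (\<lambda>n. g n * (pochhammer (\<mu> / 2) n * pochhammer ((\<mu> + 1) / 2) n
                          / (pochhammer (1 / 2) n * fact n)))"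
    by (simp add: g_series_def)
next
  show "coeffwise_log_convex (g_series g)"
    unfolding coeffwise_log_convex_def
  proof (intro allI impI)
    fix \<mu> \<alpha> \<beta> :: real and k :: nat
    assume pos: "0 < \<mu>" "0 \<le> \<alpha>" "0 \<le> \<beta>"
    define c where "c j = even_poch (\<mu> + \<alpha>) j * even_poch (\<mu> + \<beta>) (k - j)
        - even_poch \<mu> j * even_poch (\<mu> + \<alpha> + \<beta>) (k - j)" for j
    define w where "w j = c j + c (k - j)" for j
    define h where "h j = g j * g (k - j)" for j
    have w_eq: "w j = poch_turan \<mu> \<alpha> \<beta> (2 * j) (2 * (k - j))
        / (fact (2 * j) * fact (2 * (k - j)))" if "j \<le> k" for j
      using that
      by (simp add: w_def c_def even_poch_def poch_turan_def add_divide_distrib diff_divide_distrib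
          mult_ac del: fact_double)
    have "(\<Sum>j\<le>k. h j * w j) \<le> 0"
    proof (rule sum_symmetric_sign_change_nonpos)
      show "0 \<le> h j" for j
        by (simp add: h_def log_convex_seq_nonneg assms)
      show "h (k - j) = h j" "w (k - j) = w j" if "j \<le> k" for j
        using that by (simp_all add: h_def w_def)
      show "h i \<le> h j" if "j \<le> i" "2 * i \<le> k" for i j
        unfolding h_def using assms that by (rule log_convex_seq_prod_antimono)
      show "0 \<le> w i" if "j \<le> i" "2 * i \<le> k" "0 \<le> w j" for i j
      proof -
        from that have "0 \<le> poch_turan \<mu> \<alpha> \<beta> (2 * j) (2 * (k - j))"
          by (simp add: w_eq zero_le_divide_iff mult_le_0_iff fact_gt_zero[unfolded not_le[symmetric]])
        then have "0 \<le> poch_turan \<mu> \<alpha> \<beta> (2 * i) (2 * (k - i))"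
          using poch_turan_mono_sign[OF pos] that by blast
        then show ?thesis using that by (simp add: w_eq)
      qed
      \<comment> \<open>The case of constant \<open>g\<close>: coefficient \<open>k\<close> in x is
        coefficient \<open>2 * k\<close> in y, where x = y^2.\<close>
      have "4 * (\<Sum>j\<le>k. c j) \<le> 0"
        using cosh_binom_turan_nonpos[OF pos, of "2 * k"]
        by (simp add: cosh_binom_mult_nth c_def sum_subtractf)
      then show "(\<Sum>j\<le>k. w j) \<le> 0"
        by (simp add: w_def sum_atMost_symmetrise)
    qed
    also have "(\<Sum>j\<le>k. h j * w j) = (\<Sum>j\<le>k. h j * c j + h (k - j) * c (k - j))"
      by (intro sum.cong refl) (simp add: h_def w_def algebra_simps)
    also have "\<dots> = 2 * (\<Sum>j\<le>k. h j * c j)"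
      by (rule sum_atMost_symmetrise)
    also have "(\<Sum>j\<le>k. h j * c j) = fps_nth (turanian (g_series g) \<mu> \<alpha> \<beta>) k"
      by (simp add: turanian_def g_series_def fps_mult_nth h_def c_def even_poch_def
          atMost_atLeast0 algebra_simps flip: sum_subtractf)
    finally show "fps_nth (turanian (g_series g) \<mu> \<alpha> \<beta>) k \<le> 0" by simp
  qed
qed

end
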